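(* Let $\ell_1,\dots,\ell_n:\mathbb{R}^d\to\mathbb{R}$ be continuously differentiable functions whose gradients are $L$-Lipschitz continuous ($L>0$), with $\inf_{x\in\mathbb{R}^d}\ell_i(x)>-\infty$ for every $i$. Let $\mathcal{X}_i^*$ be the set of global minimizers of $\ell_i$, and assume that $\mathcal{X}^*:=\bigcap_{i=1}^n\mathcal{X}_i^*$ is non-empty and bounded. Let $0<\eta<\frac1L$, and let $\{x_k\}_{k\ge 0}$ be the sequence generated from an initial point $x_0\in\mathbb{R}^d$ by SGD with learning rate $\eta$ and cyclic sampling with reshuffle, with epoch permutations $\pi_B$ and sampled indices $\xi_k$. Assume that SGD follows an epochwise star-convex path for a certain $x^*\in\mathcal{X}^*$, i.e. for every epoch $B=0,1,2,\dots$, $$\sum_{k=nB}^{n(B+1)-1}\Big[\ell_{\xi_k}(x_k)-\ell_{\xi_k}(x^* )+\langle x^*-x_k,\nabla\ell_{\xi_k}(x_k)\rangle\Big]\le 0 .$$ Then, for every $v\in\{1,\dots,n\}$, the subsequence $\{x_{nB+\pi_B^{-1}(v)}\}_{B\ge 0}$ satisfies: 1. It is a minimizing sequence for $\ell_v$: $$\lim_{B\to\infty}\ell_v\big(x_{nB+\pi_B^{-1}(v)}\big)=\inf_{x\in\mathbb{R}^d}\ell_v(x).$$ 2. Every limit point of $\{x_{nB+\pi_B^{-1}(v)}\}_{B\ge 0}$ belongs to $\mathcal{X}_v^*$.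
   Context: The underlying problem is $\min_{x\in\mathbb{R}^d} f(x):=\frac1n\sum_{i=1}^n\ell_i(x)$. $\|\cdot\|$ and $\langle\cdot,\cdot\rangle$ are the Euclidean norm and inner product. SGD with cyclic sampling with reshuffle: for each epoch $B=0,1,2,\dots$, $\pi_B$ is a (randomly drawn) permutation of $\{1,\dots,n\}$. Every iteration index is written $k=nB+t$ with $B\ge 0$ and $t\in\{0,\dots,n-1\}$, the sampled index is $\xi_k=\pi_B(t+1)$, and the update is $x_{k+1}=x_k-\eta\nabla\ell_{\xi_k}(x_k)$ for $k=0,1,2,\dots$. The hypothesis and the conclusion both concern the realized path, for the realized sequence of permutations. $\pi_B^{-1}$ is the inverse permutation of $\pi_B$: $\pi_B^{-1}(u)=v$ if and only if $\pi_B(v)=u$; its values lie in $\{1,\dots,n\}$. A limit point of a sequence means the limit of some convergent subsequence. *)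

theory Defs
  imports "HOL-Analysis.Analysis" "HOL-Combinatorics.Permutations"
begin

(* Only meaningful where f is differentiable; see GDERIV_gradient below. *)
definition gradient :: "('a::euclidean_space \<Rightarrow> real) \<Rightarrow> 'a \<Rightarrow> 'a" where
  "gradient f x = (THE D. GDERIV f x :> D)"

lemma GDERIV_unique:
  assumes "GDERIV f x :> D" and "GDERIV f x :> D'"
  shows "D = D'"
proof -
  have "(\<lambda>h. inner h D) = (\<lambda>h. inner h D')"
    using assms unfolding gderiv_def by (rule has_derivative_unique)
  then have "inner h D = inner h D'" for h
    by meson
  then have "inner (D - D') (D - D') = 0"
    by (simp add: inner_diff_right)
  then show ?thesis
    by simp
qed

lemma GDERIV_gradient:
  fixes f :: "'a::euclidean_space \<Rightarrow> real"
  assumes "f differentiable (at x)"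
  shows "GDERIV f x :> gradient f x"
proof -
  obtain f' where f': "(f has_derivative f') (at x)"
    using assms by (auto simp: differentiable_def)
  then have lin: "linear f'"
    by (rule has_derivative_linear)
  have "f' h = inner h (\<Sum>b\<in>Basis. f' b *\<^sub>R b)" for h
  proof -
    have "f' h = f' (\<Sum>b\<in>Basis. inner h b *\<^sub>R b)"
      by (simp add: euclidean_representation)
    also have "\<dots> = (\<Sum>b\<in>Basis. inner h b * f' b)"
      using lin by (simp add: linear_sum linear_scale)
    finally show ?thesis
      by (simp add: inner_sum_right mult.commute)
  qed
  then have "f' = (\<lambda>h. inner h (\<Sum>b\<in>Basis. f' b *\<^sub>R b))"
    by blast
  then have "GDERIV f x :> (\<Sum>b\<in>Basis. f' b *\<^sub>R b)"
    using f' unfolding gderiv_def by simp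
  then show ?thesis
    unfolding gradient_def by (metis theI GDERIV_unique)
qed

definition continuously_differentiable :: "('a::euclidean_space \<Rightarrow> real) \<Rightarrow> bool" where
  "continuously_differentiable f \<longleftrightarrow>
     (\<forall>x. f differentiable (at x)) \<and> continuous_on UNIV (gradient f)"

definition global_minimizers :: "('a \<Rightarrow> real) \<Rightarrow> 'a set" where
  "global_minimizers f = {x. is_arg_min f (\<lambda>_. True) x}"

definition sequential_limit_point :: "(nat \<Rightarrow> 'a::topological_space) \<Rightarrow> 'a \<Rightarrow> bool" where
  "sequential_limit_point X z \<longleftrightarrow> (\<exists>r. strict_mono r \<and> (X \<circ> r) \<longlonglongrightarrow> z)"

(* Iteration k lies in epoch k div n at position k mod n; the epoch permutations
   act on {1..n}, hence the Suc. *)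
definition sampled_index :: "nat \<Rightarrow> (nat \<Rightarrow> nat \<Rightarrow> nat) \<Rightarrow> nat \<Rightarrow> nat" where
  "sampled_index n \<pi> k = \<pi> (k div n) (Suc (k mod n))"

lemma sampled_index_epoch:
  "t < n \<Longrightarrow> sampled_index n \<pi> (n * B + t) = \<pi> B (t + 1)"
  by (simp add: sampled_index_def)

definition sgd_path ::
    "(nat \<Rightarrow> 'a::euclidean_space \<Rightarrow> real) \<Rightarrow> real \<Rightarrow> (nat \<Rightarrow> nat) \<Rightarrow> 'a \<Rightarrow> (nat \<Rightarrow> 'a) \<Rightarrow> bool" where
  "sgd_path l \<eta> \<xi> x0 x \<longleftrightarrow>
     x 0 = x0 \<and> (\<forall>k. x (Suc k) = x k - \<eta> *\<^sub>R gradient (l (\<xi> k)) (x k))"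

definition epochwise_star_convex_path ::
    "nat \<Rightarrow> (nat \<Rightarrow> 'a::euclidean_space \<Rightarrow> real) \<Rightarrow> (nat \<Rightarrow> nat) \<Rightarrow> (nat \<Rightarrow> 'a) \<Rightarrow> 'a \<Rightarrow> bool" where
  "epochwise_star_convex_path n l \<xi> x xstar \<longleftrightarrow>
     (\<forall>B. (\<Sum>k = n * B..<n * (B + 1).
        l (\<xi> k) (x k) - l (\<xi> k) xstar
          + inner (xstar - x k) (gradient (l (\<xi> k)) (x k))) \<le> 0)"

end

(* For smooth functions the squared gradient norm is at most 2 L times the gap to the
   minimum. Expanding the squared distance to xstar along one epoch and using the
   star-convexity hypothesis, the squared distance therefore drops by at least
   2 eta (1 - eta L) times the sum of the gaps of the sampled losses over the epoch. These
   gaps are thus summable and tend to 0. Since a gradient step on l v does not increase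
   l v, the value right after the step that samples v tends to its infimum as well. *)
theory Submission
  imports Defs
begin

text \<open>On the segment from \<open>x\<close> to \<open>y\<close>, let \<open>p\<close> be
  \<open>f\<close> minus the linear part and the quadratic term. Cauchy-Schwarz and the Lipschitz
  bound make the derivative of \<open>p\<close> nonpositive for \<open>t\<close> \<ge> 0, so
  \<open>p 1\<close> \<le> \<open>p 0\<close>, which is the claim.\<close>

lemma descent_lemma:
  fixes f :: "'a::euclidean_space \<Rightarrow> real"
  assumes df: "\<And>x. f differentiable (at x)"
    and lip: "L-lipschitz_on UNIV (gradient f)"
  shows "f y \<le> f x + inner (y - x) (gradient f x) + L / 2 * (norm (y - x))\<^sup>2"
proof -
  define d where "d = y - x"
  define p where "p = (\<lambda>t. f (x + t *\<^sub>R d) - t * inner d (gradient f x) - L / 2 * t\<^sup>2 * (norm d)\<^sup>2)"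
  have deriv: "(p has_real_derivative
      inner d (gradient f (x + t *\<^sub>R d)) - inner d (gradient f x) - L * t * (norm d)\<^sup>2) (at t)" for t
  proof -
    have "(f has_derivative (\<lambda>h. inner h (gradient f (x + t *\<^sub>R d)))) (at (x + t *\<^sub>R d))"
      using GDERIV_gradient[OF df] by (simp add: gderiv_def)
    moreover have "((\<lambda>t. x + t *\<^sub>R d) has_derivative (\<lambda>h. h *\<^sub>R d)) (at t)"
      by (auto intro!: derivative_eq_intros)
    ultimately have "((\<lambda>t. f (x + t *\<^sub>R d)) has_derivative
        (\<lambda>h. inner (h *\<^sub>R d) (gradient f (x + t *\<^sub>R d)))) (at t)"
      using has_derivative_compose[of "\<lambda>t. x + t *\<^sub>R d"] by blast
    then have "((\<lambda>t. f (x + t *\<^sub>R d)) has_real_derivative inner d (gradient f (x + t *\<^sub>R d))) (at t)"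
      by (simp add: has_field_derivative_def mult_commute_abs)
    then show ?thesis
      unfolding p_def by (auto intro!: derivative_eq_intros simp: power2_eq_square)
  qed
  have nonpos: "inner d (gradient f (x + t *\<^sub>R d)) - inner d (gradient f x) - L * t * (norm d)\<^sup>2 \<le> 0"
    if "0 \<le> t" for t
  proof -
    have "inner d (gradient f (x + t *\<^sub>R d)) - inner d (gradient f x)
        = inner d (gradient f (x + t *\<^sub>R d) - gradient f x)"
      by (simp add: inner_diff_right)
    also have "\<dots> \<le> norm d * norm (gradient f (x + t *\<^sub>R d) - gradient f x)"
      by (rule norm_cauchy_schwarz)
    also have "\<dots> \<le> norm d * (L * (t * norm d))"
      using lipschitz_onD[OF lip, of "x + t *\<^sub>R d" x] that
      by (intro mult_left_mono) (auto simp: dist_norm)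
    finally show ?thesis
      by (simp add: power2_eq_square mult_ac)
  qed
  have "p 1 \<le> p 0"
    by (rule DERIV_nonpos_imp_nonincreasing[of 0 1 p, OF zero_le_one]) (use deriv nonpos in blast)
  then show ?thesis
    by (simp add: p_def d_def)
qed

text \<open>The descent lemma at the point reached by the step. The length \<open>s\<close> stays
  free because two lengths are used later: \<open>1 / L\<close> to bound the gradient, and
  \<open>\<eta>\<close> for the actual SGD step.\<close>

lemma gradient_step_decrease:
  fixes f :: "'a::euclidean_space \<Rightarrow> real"
  assumes "\<And>x. f differentiable (at x)"
    and "L-lipschitz_on UNIV (gradient f)"
  shows "f (x - s *\<^sub>R gradient f x) \<le> f x - s * (1 - L * s / 2) * (norm (gradient f x))\<^sup>2"
  using descent_lemma[OF assms, of "x - s *\<^sub>R gradient f x" x]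
  by (simp add: power_mult_distrib dot_square_norm algebra_simps power2_eq_square)

text \<open>The length \<open>1 / L\<close> maximizes the guaranteed decrease
  \<open>s * (1 - L * s / 2)\<close>. A step of this length lowers \<open>f\<close> by at least the
  squared gradient norm over \<open>2 * L\<close>, and the value reached is still at least
  \<open>c\<close>.\<close>

lemma gradient_norm_le_gap:
  fixes f :: "'a::euclidean_space \<Rightarrow> real"
  assumes "\<And>x. f differentiable (at x)"
    and "L-lipschitz_on UNIV (gradient f)"
    and "L > 0" and lower: "\<And>y. c \<le> f y"
  shows "(norm (gradient f x))\<^sup>2 \<le> 2 * L * (f x - c)"
proof -
  have "c \<le> f x - (1 / L) * (1 - L * (1 / L) / 2) * (norm (gradient f x))\<^sup>2"
    using lower gradient_step_decrease[OF assms(1,2)] order_trans by blast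
  then show ?thesis
    using \<open>L > 0\<close> by (simp add: field_simps)
qed

text \<open>Used inside one epoch, from \<open>m = n * B\<close>, and across epochs, from
  \<open>m = 0\<close>. The terms \<open>b k\<close> may have any sign, since single SGD steps can
  increase the distance to \<open>xstar\<close>.\<close>

lemma sum_le_telescope:
  fixes a b :: "nat \<Rightarrow> real"
  assumes "\<And>k. a (Suc k) \<le> a k - b k"
  shows "a (m + j) \<le> a m - sum b {m..<m + j}"
proof (induction j)
  case (Suc j)
  then show ?case
    using assms[of "m + j"] by simp
qed simp

text \<open>Telescoping bounds every partial sum of \<open>c\<close> by \<open>a 0\<close>, so the
  nonnegative series converges and its terms vanish.\<close>

lemma tendsto_zero_if_decrement:
  fixes a c :: "nat \<Rightarrow> real"
  assumes "\<And>B. a (Suc B) \<le> a B - c B" and "\<And>B. 0 \<le> a B" and "\<And>B. 0 \<le> c B"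
  shows "c \<longlonglongrightarrow> 0"
proof -
  have "sum c {..<N} \<le> a 0" for N
    using sum_le_telescope[of a c 0 N] assms(1) assms(2)[of N] by (simp add: lessThan_atLeast0)
  then have "summable c"
    by (intro summableI_nonneg_bounded assms(3))
  then show ?thesis
    by (rule summable_LIMSEQ_zero)
qed

lemma global_minimizers_iff: "z \<in> global_minimizers f \<longleftrightarrow> (\<forall>y. f z \<le> f y)"
  for f :: "'a \<Rightarrow> real"
  by (auto simp: global_minimizers_def is_arg_min_linorder)

lemma INF_eq_global_minimum:
  fixes f :: "'a \<Rightarrow> real"
  assumes "z \<in> global_minimizers f"
  shows "(INF y. f y) = f z"
  using assms unfolding global_minimizers_iff by (intro cInf_eq_minimum) auto

theorem theorem2:
  fixes n :: nat
    and l :: "nat \<Rightarrow> real ^ 'd \<Rightarrow> real"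
    and L \<eta> :: real
    and \<pi> :: "nat \<Rightarrow> nat \<Rightarrow> nat"
    and x0 xstar :: "real ^ 'd"
    and x :: "nat \<Rightarrow> real ^ 'd"
  assumes "n \<ge> 1"
    and "L > 0"
    and "\<And>i. i \<in> {1..n} \<Longrightarrow> continuously_differentiable (l i)"
    and "\<And>i. i \<in> {1..n} \<Longrightarrow> L-lipschitz_on UNIV (gradient (l i))"
    and "\<And>i. i \<in> {1..n} \<Longrightarrow> bdd_below (range (l i))"
    and "(\<Inter>i\<in>{1..n}. global_minimizers (l i)) \<noteq> {}"
    and "bounded (\<Inter>i\<in>{1..n}. global_minimizers (l i))"
    and "0 < \<eta>" and "\<eta> < 1 / L"
    and "\<And>B. \<pi> B permutes {1..n}"
    and "sgd_path l \<eta> (sampled_index n \<pi>) x0 x"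
    and "xstar \<in> (\<Inter>i\<in>{1..n}. global_minimizers (l i))"
    and "epochwise_star_convex_path n l (sampled_index n \<pi>) x xstar"
  shows "\<forall>v\<in>{1..n}.
           (\<lambda>B. l v (x (n * B + inv (\<pi> B) v))) \<longlonglongrightarrow> (INF y. l v y)
         \<and> (\<forall>z. sequential_limit_point (\<lambda>B. x (n * B + inv (\<pi> B) v)) z
                  \<longrightarrow> z \<in> global_minimizers (l v))"
proof -
  define \<xi> where "\<xi> = sampled_index n \<pi>"
  define g where "g k = gradient (l (\<xi> k)) (x k)" for k
  define D where "D k = l (\<xi> k) (x k) - l (\<xi> k) xstar" for k
  \<comment> \<open>What remains of \<open>2 * \<eta>\<close> after the squared gradient term has
    cost up to \<open>2 * \<eta>\<^sup>2 * L\<close> per unit of gap.\<close>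
  define c where "c = 2 * \<eta> * (1 - \<eta> * L)"
  have diff: "\<And>y. l i differentiable (at y)" if "i \<in> {1..n}" for i
    using assms(3)[OF that] by (simp add: continuously_differentiable_def)
  have min: "l i xstar \<le> l i y" if "i \<in> {1..n}" for i y
    using assms(12) that by (auto simp: global_minimizers_iff)
  have eL: "\<eta> * L < 1"
    using assms(2,9) by (simp add: field_simps)
  have c_pos: "c > 0"
    using eL assms(8) by (simp add: c_def)
  have \<xi>_in: "\<xi> k \<in> {1..n}" for k
  proof -
    have "Suc (k mod n) \<in> {1..n}"
      using assms(1) by (simp add: Suc_leI)
    then show ?thesis
      unfolding \<xi>_def sampled_index_def using permutes_in_image[OF assms(10)] by blast
  qed
  have step: "x (Suc k) = x k - \<eta> *\<^sub>R g k" for k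
    using assms(11) by (simp add: sgd_path_def g_def \<xi>_def)
  have D_nonneg: "0 \<le> D k" for k
    using min[OF \<xi>_in] by (simp add: D_def)
  have g_le: "(norm (g k))\<^sup>2 \<le> 2 * L * D k" for k
    unfolding g_def D_def
    by (rule gradient_norm_le_gap[OF diff[OF \<xi>_in] assms(4)[OF \<xi>_in] assms(2) min[OF \<xi>_in]])
  \<comment> \<open>Adding and subtracting \<open>2 * \<eta> * D k\<close> isolates the summand of
    the star-convexity hypothesis. Its sign is known only after summation over an epoch, so it is
    carried along here.\<close>
  have dist_step: "(norm (x (Suc k) - xstar))\<^sup>2
      \<le> (norm (x k - xstar))\<^sup>2 - (c * D k - 2 * \<eta> * (D k + inner (xstar - x k) (g k)))" for k
  proof -
    have "(norm (x (Suc k) - xstar))\<^sup>2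
        = (norm (x k - xstar))\<^sup>2 + 2 * \<eta> * inner (xstar - x k) (g k) + \<eta>\<^sup>2 * (norm (g k))\<^sup>2"
      unfolding step power2_norm_eq_inner
      by (simp add: inner_diff_left inner_diff_right inner_commute algebra_simps power2_eq_square)
    also have "\<dots> \<le> (norm (x k - xstar))\<^sup>2 + 2 * \<eta> * inner (xstar - x k) (g k) + \<eta>\<^sup>2 * (2 * L * D k)"
      using g_le by (intro add_left_mono mult_left_mono) auto
    finally show ?thesis
      by (simp add: c_def algebra_simps power2_eq_square)
  qed
  define S where "S B = (\<Sum>k = n * B..<n * B + n. D k)" for B
  have epoch: "(norm (x (n * Suc B) - xstar))\<^sup>2 \<le> (norm (x (n * B) - xstar))\<^sup>2 - c * S B" for B
  proof -
    have "(\<Sum>k = n * B..<n * B + n. D k + inner (xstar - x k) (g k)) \<le> 0"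
      using assms(13)
      by (simp add: epochwise_star_convex_path_def D_def g_def \<xi>_def algebra_simps)
    then have "2 * \<eta> * (\<Sum>k = n * B..<n * B + n. D k + inner (xstar - x k) (g k)) \<le> 0"
      using assms(8) by (simp add: mult_le_0_iff)
    moreover have "(norm (x (n * B + n) - xstar))\<^sup>2 \<le> (norm (x (n * B) - xstar))\<^sup>2
        - (\<Sum>k = n * B..<n * B + n. c * D k - 2 * \<eta> * (D k + inner (xstar - x k) (g k)))"
      by (rule sum_le_telescope[of "\<lambda>k. (norm (x k - xstar))\<^sup>2", OF dist_step])
    ultimately show ?thesis
      by (simp add: S_def sum_subtractf sum_distrib_left[symmetric] add.commute)
  qed
  have "(\<lambda>B. c * S B) \<longlonglongrightarrow> 0"
    by (rule tendsto_zero_if_decrement[of "\<lambda>B. (norm (x (n * B) - xstar))\<^sup>2", OF epoch])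
       (use c_pos D_nonneg in \<open>auto simp: S_def intro!: sum_nonneg mult_nonneg_nonneg\<close>)
  then have S_lim: "S \<longlonglongrightarrow> 0"
    using c_pos tendsto_mult_left_iff[of c S 0] by simp
  show ?thesis
  proof (intro ballI conjI allI impI)
    fix v assume v: "v \<in> {1..n}"
    define X where "X B = x (n * B + inv (\<pi> B) v)" for B
    have gap: "l v (X B) - l v xstar \<le> S B" for B
    proof -
      have "inv (\<pi> B) v \<in> {1..n}"
        using permutes_in_image[OF permutes_inv[OF assms(10)]] v by blast
      \<comment> \<open>Positions in an epoch count from 1 but offsets from 0: \<open>l v\<close> is
        sampled at iteration \<open>n * B + t\<close>, and \<open>X B\<close> is the iterate right
        after that update. For \<open>t = n - 1\<close> it is already the first iterate of the next
        epoch.\<close>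
      then obtain t where t: "inv (\<pi> B) v = Suc t" "t < n"
        by (cases "inv (\<pi> B) v") auto
      have \<xi>_v: "\<xi> (n * B + t) = v"
        using permutes_inverses(1)[OF assms(10), of B v] t
        by (simp add: \<xi>_def sampled_index_epoch)
      \<comment> \<open>This is the guaranteed decrease of \<open>l v\<close> in the step that
        samples it; as it is nonnegative, the gap at \<open>X B\<close> is at most the gap before
        the step.\<close>
      have "0 \<le> \<eta> * (1 - L * \<eta> / 2) * (norm (g (n * B + t)))\<^sup>2"
        using assms(8) eL by (intro mult_nonneg_nonneg) (auto simp: mult.commute)
      then have "l v (X B) \<le> l v (x (n * B + t))"
        using gradient_step_decrease[OF diff[OF v] assms(4)[OF v], of "x (n * B + t)" \<eta>]
        by (simp add: X_def t step g_def \<xi>_v)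
      then have "l v (X B) - l v xstar \<le> D (n * B + t)"
        by (simp add: D_def \<xi>_v)
      also have "\<dots> \<le> S B"
        unfolding S_def using t D_nonneg by (intro member_le_sum) auto
      finally show ?thesis .
    qed
    have "(\<lambda>B. l v (X B) - l v xstar) \<longlonglongrightarrow> 0"
      by (rule tendsto_sandwich[OF _ _ tendsto_const S_lim]) (use gap min[OF v] in auto)
    then have lim: "(\<lambda>B. l v (X B)) \<longlonglongrightarrow> l v xstar"
      by (rule LIM_zero_cancel)
    then show "(\<lambda>B. l v (x (n * B + inv (\<pi> B) v))) \<longlonglongrightarrow> (INF y. l v y)"
      using INF_eq_global_minimum[of xstar "l v"] assms(12) v by (simp add: X_def)
    fix z assume "sequential_limit_point (\<lambda>B. x (n * B + inv (\<pi> B) v)) z"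
    then obtain r where r: "strict_mono r" "(X \<circ> r) \<longlonglongrightarrow> z"
      unfolding sequential_limit_point_def X_def[abs_def, symmetric] by blast
    \<comment> \<open>By continuity the values of \<open>l v\<close> along the subsequence tend to
      \<open>l v z\<close>, while by the first claim they tend to the minimum
      \<open>l v xstar\<close>.\<close>
    have "isCont (l v) z"
      using diff[OF v] differentiable_imp_continuous_within by blast
    then have "(\<lambda>B. l v ((X \<circ> r) B)) \<longlonglongrightarrow> l v z"
      using r(2) by (rule isCont_tendsto_compose)
    moreover have "(\<lambda>B. l v ((X \<circ> r) B)) \<longlonglongrightarrow> l v xstar"
      using LIMSEQ_subseq_LIMSEQ[OF lim r(1)] by (simp add: o_def)
    ultimately have "l v z = l v xstar"
      by (rule LIMSEQ_unique)
    then show "z \<in> global_minimizers (l v)"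
      using min[OF v] by (simp add: global_minimizers_iff)
  qed
qed

end
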